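(* There exists an algorithm that, given a generalized partition matroid $\mathcal{M}=(U,\mathcal{I})$, a monotone submodular function $f\colon 2^U\to\mathbb{R}_+$ (accessible through a value oracle to its multilinear extension $F$), and $0<\varepsilon\le 1$, performs in expectation $O(n\ln^2(1/\varepsilon))$ evaluations of $F$ and finds $A\in\mathcal{I}$ satisfying $\mathbb{E}[f(A)]\ge(1-\varepsilon)(1-1/e)f(O)$, where $n=|U|$ and $O\in\arg\max\{f(S):S\in\mathcal{I}\}$ is an optimal base.
   Context: A generalized partition matroid on $U$ is given by a partition $U_1,\dots,U_k$ of $U$ and bounds $\ell_1,\dots,\ell_k\in\mathbb{N}$; $S\in\mathcal{I}$ iff $|S\cap U_j|\le\ell_j$ for all $j\in[k]$. Submodular: $f(S+i)-f(S)\ge f(T+i)-f(T)$ for $S\subseteq T\subseteq U$, $i\notin T$; monotone: $f(S)\le f(T)$ for $S\subseteq T$. The multilinear extension is $F(\mathbf{x})=\sum_{S\subseteq U}f(S)\prod_{i\in S}x_i\prod_{i\notin S}(1-x_i)$. *)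

theory Defs
  imports "HOL-Probability.Probability"
begin

text \<open>
  Ground sets are finite sets of natural numbers. A concrete infinite type of element names keeps
  the size of the ground set a parameter, so that the constant of a complexity bound cannot depend
  on it through the type.
\<close>

(* Blocks are indexed by {1..k} and may be empty. *)
definition gen_partition :: "nat set \<Rightarrow> nat \<Rightarrow> (nat \<Rightarrow> nat set) \<Rightarrow> bool" where
  "gen_partition U k V \<longleftrightarrow>
     finite U \<and> (\<Union>j\<in>{1..k}. V j) = U \<and> disjoint_family_on V {1..k}"

definition gen_partition_indep ::
    "nat set \<Rightarrow> nat \<Rightarrow> (nat \<Rightarrow> nat set) \<Rightarrow> (nat \<Rightarrow> nat) \<Rightarrow> nat set set" where
  "gen_partition_indep U k V l = {S. S \<subseteq> U \<and> (\<forall>j\<in>{1..k}. card (S \<inter> V j) \<le> l j)}"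

definition nonneg_setfun :: "nat set \<Rightarrow> (nat set \<Rightarrow> real) \<Rightarrow> bool" where
  "nonneg_setfun U f \<longleftrightarrow> (\<forall>S. S \<subseteq> U \<longrightarrow> 0 \<le> f S)"

definition monotone_setfun :: "nat set \<Rightarrow> (nat set \<Rightarrow> real) \<Rightarrow> bool" where
  "monotone_setfun U f \<longleftrightarrow> (\<forall>S T. S \<subseteq> T \<and> T \<subseteq> U \<longrightarrow> f S \<le> f T)"

definition submodular_setfun :: "nat set \<Rightarrow> (nat set \<Rightarrow> real) \<Rightarrow> bool" where
  "submodular_setfun U f \<longleftrightarrow>
     (\<forall>S T i. S \<subseteq> T \<and> T \<subseteq> U \<and> i \<in> U - T \<longrightarrow>
        f (insert i S) - f S \<ge> f (insert i T) - f T)"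

definition multilinear_ext :: "nat set \<Rightarrow> (nat set \<Rightarrow> real) \<Rightarrow> (nat \<Rightarrow> real) \<Rightarrow> real" where
  "multilinear_ext U f x =
     (\<Sum>S\<in>Pow U. f S * (\<Prod>i\<in>S. x i) * (\<Prod>i\<in>U - S. 1 - x i))"

text \<open>
  Randomized oracle algorithms as adaptive decision trees: an algorithm stops with an output set,
  or queries the oracle at a point and continues depending on the real number it answers, or
  draws a random natural number (from a distribution of its choice) and continues depending on it.
  Only oracle queries are charged; the computation between two queries is not restricted.
\<close>

datatype oracle_alg =
    Return "nat set"
  | Query "nat \<Rightarrow> real" "real \<Rightarrow> oracle_alg"
  | Sample "nat pmf" "nat \<Rightarrow> oracle_alg"

(* The oracle may only be consulted inside the unit cube [0,1]^U. *)
primrec queries_in_cube :: "nat set \<Rightarrow> oracle_alg \<Rightarrow> bool" where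
  "queries_in_cube U (Return A) \<longleftrightarrow> True"
| "queries_in_cube U (Query x c) \<longleftrightarrow> (\<forall>i\<in>U. 0 \<le> x i \<and> x i \<le> 1) \<and> (\<forall>y. queries_in_cube U (c y))"
| "queries_in_cube U (Sample p c) \<longleftrightarrow> (\<forall>w. queries_in_cube U (c w))"

(* Joint distribution of the output and of the number of oracle queries made. *)
primrec run :: "((nat \<Rightarrow> real) \<Rightarrow> real) \<Rightarrow> oracle_alg \<Rightarrow> (nat set \<times> nat) pmf" where
  "run F (Return A) = return_pmf (A, 0)"
| "run F (Query x c) = map_pmf (\<lambda>(A, q). (A, Suc q)) (run F (c (F x)))"
| "run F (Sample p c) = bind_pmf p (\<lambda>w. run F (c w))"

(* A nonnegative integral, so that an infinite expectation is not mistaken for 0. *)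
definition expected_queries :: "(nat set \<times> nat) pmf \<Rightarrow> ennreal" where
  "expected_queries r = (\<integral>\<^sup>+ z. of_nat (snd z) \<partial>measure_pmf r)"

definition expected_value :: "(nat set \<Rightarrow> real) \<Rightarrow> (nat set \<times> nat) pmf \<Rightarrow> real" where
  "expected_value f r = measure_pmf.expectation r (\<lambda>z. f (fst z))"

text \<open>
  The bound meant by a running time of order \<open>n ln\<^sup>2(1/\<epsilon>)\<close>. For \<open>\<epsilon> \<le> exp (-1)\<close> it is exactly
  \<open>n ln\<^sup>2(1/\<epsilon>)\<close>. As usual for asymptotics in \<open>1/\<epsilon>\<close>, the logarithmic factor is not allowed to drop
  below 1: at \<open>\<epsilon>\<close> close to 1 it would tend to 0 and demand fewer than one query on average.
\<close>

definition n_log_sq :: "nat \<Rightarrow> real \<Rightarrow> real" where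
  "n_log_sq n \<epsilon> = real n * (max 1 (ln (1 / \<epsilon>)))\<^sup>2"

end

theory Submission
  imports Defs
begin

text \<open>
  The algorithm is a local search whose objective changes with time. A bound \<open>l\<^sub>j\<close> gives block \<open>j\<close>
  as many slots. Let \<open>G p\<close> be the expected value of \<open>f\<close> on the contents of the slots when each slot is
  kept with probability \<open>p\<close>; it is \<open>F\<close> at a single point of the cube. A step draws a random element \<open>u\<close>
  and a random slot of its block, and puts \<open>u\<close> into that slot if this increases \<open>G p\<close>. Averaged over
  the pairs formed by an element of the optimum and a slot, the gain is proportional to
  \<open>p (f Opt - G p - G' p)\<close>. Letting \<open>p\<close> grow exponentially in time, \<open>dp = p dt\<close>, cancels the term
  \<open>- G' p\<close>, so the value \<open>y\<close> satisfies \<open>dy/dp \<ge> f Opt - y\<close>. Growing from \<open>p = \<epsilon>/2\<close> to \<open>p = 1\<close> takes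
  \<open>n ln (2/\<epsilon>)\<close> non-idle steps of two queries each and gives the factor \<open>1 - 1/e\<close>.
\<close>

section \<open>The multilinear extension\<close>

lemma multilinear_ext_empty [simp]: "multilinear_ext {} g x = g {}"
  by (simp add: multilinear_ext_def)

text \<open>Subsets are split by whether they contain \<open>d\<close>, which conditions the random
  set on \<open>d\<close>. Inductions over the ground set go through this identity.\<close>

lemma multilinear_ext_insert:
  assumes "finite D" "d \<notin> D"
  shows "multilinear_ext (insert d D) g x =
    (1 - x d) * multilinear_ext D g x + x d * multilinear_ext D (\<lambda>R. g (insert d R)) x"
proof -
  let ?h = "\<lambda>S. g S * (\<Prod>i\<in>S. x i) * (\<Prod>i\<in>insert d D - S. 1 - x i)"
  have inj: "inj_on (insert d) (Pow D)"
    using assms(2) by (auto simp: inj_on_def)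
  have "multilinear_ext (insert d D) g x = sum ?h (Pow D) + sum ?h (insert d ` Pow D)"
    unfolding multilinear_ext_def Pow_insert
    using assms by (intro sum.union_disjoint) auto
  also have "sum ?h (Pow D) = (1 - x d) * multilinear_ext D g x"
    unfolding multilinear_ext_def sum_distrib_left
  proof (intro sum.cong refl)
    fix R assume "R \<in> Pow D"
    then have "insert d D - R = insert d (D - R)" using assms(2) by auto
    then show "?h R = (1 - x d) * (g R * (\<Prod>i\<in>R. x i) * (\<Prod>i\<in>D - R. 1 - x i))"
      using assms by simp
  qed
  also have "sum ?h (insert d ` Pow D) = x d * multilinear_ext D (\<lambda>R. g (insert d R)) x"
    unfolding multilinear_ext_def sum_distrib_left sum.reindex[OF inj] comp_def
  proof (intro sum.cong refl)
    fix R assume R: "R \<in> Pow D"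
    then have "insert d D - insert d R = D - R" "d \<notin> R" "finite R"
      using assms finite_subset by auto
    then show "?h (insert d R) =
        x d * (g (insert d R) * (\<Prod>i\<in>R. x i) * (\<Prod>i\<in>D - R. 1 - x i))"
      by simp
  qed
  finally show ?thesis .
qed

lemma multilinear_ext_cong:
  assumes "\<And>i. i \<in> D \<Longrightarrow> x i = y i" "\<And>R. R \<subseteq> D \<Longrightarrow> g R = h R"
  shows "multilinear_ext D g x = multilinear_ext D h y"
  unfolding multilinear_ext_def
proof (intro sum.cong refl)
  fix R assume "R \<in> Pow D"
  then have "(\<Prod>i\<in>R. x i) = (\<Prod>i\<in>R. y i)" "(\<Prod>i\<in>D - R. 1 - x i) = (\<Prod>i\<in>D - R. 1 - y i)" "g R = h R"
    using assms by (auto intro!: prod.cong)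
  then show "g R * (\<Prod>i\<in>R. x i) * (\<Prod>i\<in>D - R. 1 - x i) =
      h R * (\<Prod>i\<in>R. y i) * (\<Prod>i\<in>D - R. 1 - y i)"
    by simp
qed

lemma multilinear_ext_diff:
  "multilinear_ext D (\<lambda>R. g R - h R) x = multilinear_ext D g x - multilinear_ext D h x"
  by (simp add: multilinear_ext_def sum_subtractf left_diff_distrib)

lemma multilinear_ext_sum:
  "multilinear_ext D (\<lambda>R. \<Sum>j\<in>J. g j R) x = (\<Sum>j\<in>J. multilinear_ext D (g j) x)"
  unfolding multilinear_ext_def sum_distrib_right by (rule sum.swap)

lemma multilinear_ext_const:
  "finite D \<Longrightarrow> multilinear_ext D (\<lambda>R. c) x = c"
  by (induction rule: finite_induct) (simp_all add: multilinear_ext_insert algebra_simps)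

lemma multilinear_ext_mono:
  assumes "\<And>i. i \<in> D \<Longrightarrow> 0 \<le> x i \<and> x i \<le> 1" "\<And>R. R \<subseteq> D \<Longrightarrow> g R \<le> h R"
  shows "multilinear_ext D g x \<le> multilinear_ext D h x"
  unfolding multilinear_ext_def
  using assms by (intro sum_mono mult_right_mono prod_nonneg) (auto simp: subset_iff)

text \<open>Raising \<open>x d\<close> to \<open>y d\<close> moves weight from sets without
  \<open>d\<close> to sets with \<open>d\<close>, where an antitone function is smaller; induction
  handles the other coordinates.\<close>

lemma multilinear_ext_antimono:
  assumes "finite D"
    and "\<And>i. i \<in> D \<Longrightarrow> 0 \<le> x i \<and> x i \<le> y i \<and> y i \<le> 1"
    and "\<And>R T. R \<subseteq> T \<Longrightarrow> T \<subseteq> D \<Longrightarrow> h T \<le> h R"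
  shows "multilinear_ext D h y \<le> multilinear_ext D h x"
  using assms
proof (induction arbitrary: h rule: finite_induct)
  case (insert d D)
  let ?i = "\<lambda>R. h (insert d R)"
  have x: "0 \<le> x i \<and> x i \<le> y i \<and> y i \<le> 1" "0 \<le> x i \<and> x i \<le> 1" if "i \<in> D" for i
    using insert.prems(1)[of i] that by auto
  have 1: "multilinear_ext D h y \<le> multilinear_ext D h x"
    by (intro insert.IH x insert.prems(2)) auto
  have 2: "multilinear_ext D ?i y \<le> multilinear_ext D ?i x"
    by (intro insert.IH x insert.prems(2)) auto
  have 3: "multilinear_ext D ?i x \<le> multilinear_ext D h x"
    by (intro multilinear_ext_mono x insert.prems(2)) auto
  have xy: "0 \<le> x d" "x d \<le> y d" "y d \<le> 1" using insert.prems(1) by auto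
  have "(1 - y d) * multilinear_ext D h y + y d * multilinear_ext D ?i y \<le>
      (1 - y d) * multilinear_ext D h x + y d * multilinear_ext D ?i x"
    using 1 2 xy by (intro add_mono mult_left_mono) auto
  also have "\<dots> = (1 - x d) * multilinear_ext D h x + x d * multilinear_ext D ?i x
      - (y d - x d) * (multilinear_ext D h x - multilinear_ext D ?i x)"
    by (simp add: algebra_simps)
  also have "\<dots> \<le> (1 - x d) * multilinear_ext D h x + x d * multilinear_ext D ?i x"
    using 3 xy by simp
  finally show ?case using insert.hyps by (simp add: multilinear_ext_insert)
qed simp

text \<open>The partial derivative of the extension in coordinate \<open>d\<close> at the constant
  vector \<open>p\<close>. Summed over \<open>D\<close> it is the derivative along the diagonal, the
  \<open>G' p\<close> of the overview.\<close>

definition partial_diff :: "nat set \<Rightarrow> (nat set \<Rightarrow> real) \<Rightarrow> real \<Rightarrow> nat \<Rightarrow> real" where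
  "partial_diff D g p d =
     multilinear_ext (D - {d}) (\<lambda>R. g (insert d R) - g R) (\<lambda>_. p)"

text \<open>
  Concavity of the extension along the diagonal, as a bound by the slope at the far end; the
  coordinates are raised from \<open>q\<close> to \<open>p\<close> one at a time.
\<close>

lemma multilinear_ext_diagonal:
  assumes "finite D" "0 \<le> q" "q \<le> p" "p \<le> 1"
    and "\<And>d R T. R \<subseteq> T \<Longrightarrow> T \<subseteq> D \<Longrightarrow> d \<in> D \<Longrightarrow> g (insert d T) - g T \<le> g (insert d R) - g R"
  shows "multilinear_ext D g (\<lambda>_. q) + (p - q) * (\<Sum>d\<in>D. partial_diff D g p d)
    \<le> multilinear_ext D g (\<lambda>_. p)"
proof -
  define z where "z E = (\<lambda>d. if d \<in> E then p else q)" for E :: "nat set"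
  have "multilinear_ext D g (\<lambda>_. q) + (p - q) * (\<Sum>d\<in>E. partial_diff D g p d)
      \<le> multilinear_ext D g (z E)" if "finite E" "E \<subseteq> D" for E
    using that
  proof (induction rule: finite_induct)
    case empty
    then show ?case by (simp add: z_def)
  next
    case (insert d E)
    let ?D = "D - {d}"
    have D: "D = insert d ?D" "finite ?D" using insert.prems assms(1) by auto
    have "multilinear_ext D g (z E) = (1 - q) * multilinear_ext ?D g (z E)
        + q * multilinear_ext ?D (\<lambda>R. g (insert d R)) (z E)"
      using multilinear_ext_insert[OF D(2), of d g "z E"] D(1) insert.hyps by (simp add: z_def insert_absorb)
    moreover have "multilinear_ext D g (z (insert d E)) = (1 - p) * multilinear_ext ?D g (z E)
        + p * multilinear_ext ?D (\<lambda>R. g (insert d R)) (z E)"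
    proof -
      have c: "multilinear_ext ?D h (z (insert d E)) = multilinear_ext ?D h (z E)" for h
        by (rule multilinear_ext_cong) (auto simp: z_def)
      have "z (insert d E) d = p" by (simp add: z_def)
      then show ?thesis
        using multilinear_ext_insert[OF D(2), of d g "z (insert d E)"] D(1) c by simp
    qed
    ultimately have "multilinear_ext D g (z (insert d E)) - multilinear_ext D g (z E) =
        (p - q) * multilinear_ext ?D (\<lambda>R. g (insert d R) - g R) (z E)"
      by (simp add: multilinear_ext_diff algebra_simps)
    \<comment> \<open>The slope at \<open>z E\<close> dominates the slope at \<open>p\<close>,
      because \<open>z E\<close> lies below \<open>p\<close> and marginals are antitone.\<close>
    also have "\<dots> \<ge> (p - q) * partial_diff D g p d"
      unfolding partial_diff_def
      using assms(2-4) D(2) insert.prems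
      by (intro mult_left_mono multilinear_ext_antimono assms(5)) (auto simp: z_def)
    finally show ?case using insert by (simp add: algebra_simps)
  qed
  from this[of D] have "multilinear_ext D g (\<lambda>_. q) + (p - q) * (\<Sum>d\<in>D. partial_diff D g p d)
      \<le> multilinear_ext D g (z D)"
    using assms(1) by blast
  also have "multilinear_ext D g (z D) = multilinear_ext D g (\<lambda>_. p)"
    by (rule multilinear_ext_cong) (auto simp: z_def)
  finally show ?thesis .
qed

text \<open>A further independent copy of \<open>v\<close>, kept with probability \<open>p\<close>,
  multiplies the probability of missing \<open>v\<close> by \<open>1 - p\<close>.\<close>

lemma multilinear_ext_insert_value:
  assumes "finite U" "v \<in> U"
  shows "multilinear_ext U f (x(v := 1 - (1 - p) * (1 - x v))) =
    (1 - p) * multilinear_ext U f x + p * multilinear_ext U (\<lambda>R. f (insert v R)) x"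
proof -
  let ?V = "U - {v}" and ?y = "x(v := 1 - (1 - p) * (1 - x v))"
  have U: "U = insert v ?V" "finite ?V" using assms by auto
  have c: "multilinear_ext ?V h ?y = multilinear_ext ?V h x" for h
    by (rule multilinear_ext_cong) auto
  have ins: "multilinear_ext U h y =
      (1 - y v) * multilinear_ext ?V h y + y v * multilinear_ext ?V (\<lambda>R. h (insert v R)) y" for h y
    using multilinear_ext_insert[OF U(2), of v h y] U(1) by simp
  show ?thesis
    unfolding ins[of f x] ins[of f ?y] ins[of "\<lambda>R. f (insert v R)" x] c
    by (simp add: algebra_simps)
qed

section \<open>Slots and the search\<close>

text \<open>
  A slot \<open>d \<in> D\<close> holds the empty set or a singleton \<open>a d\<close>, and two slots may hold the same element.
  The point below is the vector of inclusion probabilities when every slot is kept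
  independently with probability \<open>p\<close>.
\<close>

definition slot_point :: "nat set \<Rightarrow> real \<Rightarrow> (nat \<Rightarrow> nat set) \<Rightarrow> nat \<Rightarrow> real" where
  "slot_point D p a u = 1 - (1 - p) ^ card {d \<in> D. u \<in> a d}"

definition slot_value :: "(nat set \<Rightarrow> real) \<Rightarrow> nat set \<Rightarrow> real \<Rightarrow> (nat \<Rightarrow> nat set) \<Rightarrow> real" where
  "slot_value f D p a = multilinear_ext D (\<lambda>R. f (\<Union>(a ` R))) (\<lambda>_. p)"

lemma slot_point_bounds:
  "0 \<le> p \<Longrightarrow> p \<le> 1 \<Longrightarrow> 0 \<le> slot_point D p a u \<and> slot_point D p a u \<le> 1"
  by (simp add: slot_point_def power_le_one)

text \<open>Each slot holds at most one element, so distinct elements depend on disjoint sets of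
  slots and are kept independently. One oracle query therefore returns \<open>slot_value\<close>
  exactly. The induction adds slots one at a time.\<close>

lemma multilinear_ext_slot_point:
  assumes "finite U" "finite D" "\<And>d. d \<in> D \<Longrightarrow> a d = {} \<or> (\<exists>u\<in>U. a d = {u})"
  shows "multilinear_ext U f (slot_point D p a) = slot_value f D p a"
  using assms(2,3) unfolding slot_value_def
proof (induction arbitrary: f rule: finite_induct)
  case empty
  have "multilinear_ext U f (\<lambda>_. 0) = f {}"
    using assms(1)
  proof (induction arbitrary: f rule: finite_induct)
    case (insert u U)
    then show ?case by (simp add: multilinear_ext_insert)
  qed simp
  then show ?case by (simp add: slot_point_def)
next
  case (insert d D)
  have IH: "multilinear_ext U f (slot_point D p a) =
      multilinear_ext D (\<lambda>R. f (\<Union>(a ` R))) (\<lambda>_. p)" for f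
    using insert.prems by (intro insert.IH) auto
  have ad: "a d = {} \<or> (\<exists>u\<in>U. a d = {u})" using insert.prems by simp
  then show ?case
  proof
    assume a: "a d = {}"
    have eq: "{e \<in> insert d D. u \<in> a e} = {e \<in> D. u \<in> a e}" for u using a by auto
    have "slot_point (insert d D) p a = slot_point D p a"
      by (simp only: slot_point_def fun_eq_iff eq simp_thms)
    then show ?thesis
      using IH[of f] a insert.hyps by (simp add: multilinear_ext_insert algebra_simps)
  next
    assume "\<exists>u\<in>U. a d = {u}"
    then obtain v where v: "v \<in> U" "a d = {v}" by auto
    have eq: "{e \<in> insert d D. u \<in> a e} =
        (if u = v then insert d {e \<in> D. u \<in> a e} else {e \<in> D. u \<in> a e})" for u
      using v by auto
    have "slot_point (insert d D) p a =
        (slot_point D p a)(v := 1 - (1 - p) * (1 - slot_point D p a v))"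
      using insert.hyps unfolding slot_point_def fun_eq_iff eq by simp
    then have "multilinear_ext U f (slot_point (insert d D) p a) =
        (1 - p) * multilinear_ext U f (slot_point D p a) +
        p * multilinear_ext U (\<lambda>R. f (insert v R)) (slot_point D p a)"
      using multilinear_ext_insert_value[OF assms(1) v(1)] by metis
    then show ?thesis
      unfolding IH multilinear_ext_insert[OF insert.hyps] using v by simp
  qed
qed

text \<open>
  The scale at which a replacement is tested is \<open>(1 - 1/m)\<^sup>t\<close>, \<open>t\<close> being the number of steps that
  remain afterwards. A number in \<open>{..m} - U\<close> makes the step idle, without any query: for large \<open>m\<close>
  the discretization error vanishes while the expected number of queries is unaffected.
\<close>

primrec slot_search ::
    "nat set \<Rightarrow> nat set \<Rightarrow> (nat \<Rightarrow> nat set) \<Rightarrow> nat \<Rightarrow> nat \<Rightarrow> (nat \<Rightarrow> nat set) \<Rightarrow> oracle_alg" where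
  "slot_search U D S m 0 a = Return (\<Union>(a ` D))"
| "slot_search U D S m (Suc t) a =
     Sample (pmf_of_set {..m}) (\<lambda>u.
       if u \<in> U \<and> S u \<noteq> {} then
         Sample (pmf_of_set (S u)) (\<lambda>d.
           Query (slot_point D ((1 - 1 / real m) ^ t) a) (\<lambda>y.
             Query (slot_point D ((1 - 1 / real m) ^ t) (a(d := {u}))) (\<lambda>z.
               slot_search U D S m t (if y < z then a(d := {u}) else a))))
       else slot_search U D S m t a)"

section \<open>Cost and outputs of the search\<close>

lemma queries_in_cube_slot_search:
  "0 < m \<Longrightarrow> queries_in_cube U (slot_search U D S m t a)"
  by (induction t arbitrary: a) (auto intro!: slot_point_bounds[THEN conjunct1]
      slot_point_bounds[THEN conjunct2] power_le_one)

lemma finite_set_run_slot_search: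
  assumes "\<And>u. u \<in> U \<Longrightarrow> finite (S u)"
  shows "finite (set_pmf (run F (slot_search U D S m t a)))"
  by (induction t arbitrary: a) (use assms in auto)

text \<open>Of the \<open>m + 1\<close> equally likely numbers at most \<open>card U\<close> lead to
  a step with queries, and such a step makes two of them.\<close>

lemma expected_queries_slot_search:
  assumes "\<And>u. u \<in> U \<Longrightarrow> finite (S u)" "U \<subseteq> {..m}"
  shows "expected_queries (run F (slot_search U D S m t a))
    \<le> ennreal (real t * (2 * real (card U) / (real m + 1)))"
proof (induction t arbitrary: a)
  case 0
  then show ?case by (simp add: expected_queries_def)
next
  case (Suc t)
  let ?c = "real t * (2 * real (card U) / (real m + 1))"
  let ?step = "\<lambda>u. if u \<in> U \<and> S u \<noteq> {} then
         Sample (pmf_of_set (S u)) (\<lambda>d.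
           Query (slot_point D ((1 - 1 / real m) ^ t) a) (\<lambda>y.
             Query (slot_point D ((1 - 1 / real m) ^ t) (a(d := {u}))) (\<lambda>z.
               slot_search U D S m t (if y < z then a(d := {u}) else a))))
       else slot_search U D S m t a"
  have q: "(\<integral>\<^sup>+ z. of_nat (Suc (Suc (snd z))) \<partial>measure_pmf r) = 2 + expected_queries r" for r
  proof -
    have "(\<integral>\<^sup>+ z. of_nat (Suc (Suc (snd z))) \<partial>measure_pmf r) =
        (\<integral>\<^sup>+ z. 2 + of_nat (snd z) \<partial>measure_pmf r)"
      by (intro nn_integral_cong) (simp add: add.assoc[symmetric] one_add_one)
    also have "\<dots> = 2 + expected_queries r"
      unfolding expected_queries_def
      by (subst nn_integral_add) simp_all
    finally show ?thesis .
  qed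
  have step: "expected_queries (run F (?step u)) \<le> 2 * indicator U u + ennreal ?c" for u
  proof (cases "u \<in> U \<and> S u \<noteq> {}")
    case True
    have "expected_queries (run F (?step u)) =
        (\<integral>\<^sup>+ d. 2 + expected_queries (run F (slot_search U D S m t
          (if F (slot_point D ((1 - 1 / real m) ^ t) a) <
              F (slot_point D ((1 - 1 / real m) ^ t) (a(d := {u}))) then a(d := {u}) else a)))
          \<partial>measure_pmf (pmf_of_set (S u)))"
      using True unfolding q[symmetric]
      by (simp add: expected_queries_def nn_integral_bind_pmf nn_integral_map_pmf case_prod_unfold)
    also have "\<dots> \<le> (\<integral>\<^sup>+ d. 2 + ennreal ?c \<partial>measure_pmf (pmf_of_set (S u)))"
      by (intro nn_integral_mono add_left_mono Suc.IH)
    also have "\<dots> = 2 + ennreal ?c" by simp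
    finally show ?thesis using True by simp
  next
    case False
    then show ?thesis using Suc.IH[of a] by (auto intro: add_increasing)
  qed
  have "expected_queries (run F (slot_search U D S m (Suc t) a)) =
      (\<integral>\<^sup>+ u. expected_queries (run F (?step u)) \<partial>measure_pmf (pmf_of_set {..m}))"
    by (simp add: expected_queries_def nn_integral_bind_pmf)
  also have "\<dots> \<le> (\<integral>\<^sup>+ u. 2 * indicator U u + ennreal ?c \<partial>measure_pmf (pmf_of_set {..m}))"
    by (intro nn_integral_mono step)
  also have "\<dots> = 2 * emeasure (measure_pmf (pmf_of_set {..m})) U + ennreal ?c"
    by (subst nn_integral_add) (simp_all add: nn_integral_cmult)
  also have "emeasure (measure_pmf (pmf_of_set {..m})) U = ennreal (real (card U) / (real m + 1))"
    using assms(2) by (simp add: emeasure_pmf_of_set Int_absorb1 add.commute)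
  also have "2 * ennreal (real (card U) / (real m + 1)) = ennreal (2 * real (card U) / (real m + 1))"
    by (subst ennreal_mult'[symmetric, of 2, simplified]) simp_all
  also have "ennreal (2 * real (card U) / (real m + 1)) + ennreal ?c =
      ennreal (real (Suc t) * (2 * real (card U) / (real m + 1)))"
    by (subst ennreal_plus[symmetric]) (simp_all add: add_divide_distrib distrib_right)
  finally show ?case .
qed

definition slots_ok :: "nat set \<Rightarrow> nat set \<Rightarrow> (nat \<Rightarrow> nat set) \<Rightarrow> (nat \<Rightarrow> nat set) \<Rightarrow> bool" where
  "slots_ok U D S a \<longleftrightarrow> (\<forall>d\<in>D. a d = {} \<or> (\<exists>u\<in>U. d \<in> S u \<and> a d = {u}))"

lemma slots_ok_update:
  "slots_ok U D S a \<Longrightarrow> u \<in> U \<Longrightarrow> d \<in> S u \<Longrightarrow> slots_ok U D S (a(d := {u}))"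
  by (auto simp: slots_ok_def)

lemma outputs_run:
  "fst ` set_pmf (run F (Query x c)) = fst ` set_pmf (run F (c (F x)))"
  "fst ` set_pmf (run F (Sample p g)) = (\<Union>w\<in>set_pmf p. fst ` set_pmf (run F (g w)))"
  by (simp_all add: image_image case_prod_unfold image_UN)

lemma output_slot_search:
  assumes "\<And>u. u \<in> U \<Longrightarrow> finite (S u)" "slots_ok U D S a"
    and "A \<in> fst ` set_pmf (run F (slot_search U D S m t a))"
  shows "\<exists>b. slots_ok U D S b \<and> A = \<Union>(b ` D)"
  using assms(2,3)
proof (induction t arbitrary: a)
  case (Suc t)
  obtain b where "slots_ok U D S b" "A \<in> fst ` set_pmf (run F (slot_search U D S m t b))"
  proof -
    obtain u where u: "u \<le> m" "A \<in> fst ` set_pmf (run F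
        (if u \<in> U \<and> S u \<noteq> {} then
           Sample (pmf_of_set (S u)) (\<lambda>d.
             Query (slot_point D ((1 - 1 / real m) ^ t) a) (\<lambda>y.
               Query (slot_point D ((1 - 1 / real m) ^ t) (a(d := {u}))) (\<lambda>z.
                 slot_search U D S m t (if y < z then a(d := {u}) else a))))
         else slot_search U D S m t a))"
      using Suc.prems(2) by auto
    show thesis
    proof (cases "u \<in> U \<and> S u \<noteq> {}")
      case True
      then have S: "set_pmf (pmf_of_set (S u)) = S u" using assms(1) by simp
      \<comment> \<open>Feasibility does not depend on the oracle's answers: \<open>c\<close> stands
        for either outcome of the comparison.\<close>
      obtain d c where d: "d \<in> S u" "A \<in> fst ` set_pmf (run F (slot_search U D S m t
          (if c then a(d := {u}) else a)))"
        using u(2)[unfolded if_P[OF True]] unfolding outputs_run S by blast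
      then have "slots_ok U D S (if c then a(d := {u}) else a)"
        using slots_ok_update[OF Suc.prems(1)] Suc.prems(1) True by simp
      then show thesis using that d(2) by blast
    next
      case False
      then have "A \<in> fst ` set_pmf (run F (slot_search U D S m t a))"
        using u(2) by (simp only: if_False)
      then show thesis using that Suc.prems(1) by blast
    qed
  qed
  then show ?case by (rule Suc.IH)
qed auto

section \<open>The guarantee of the search\<close>

lemma multilinear_ext_one: "finite D \<Longrightarrow> multilinear_ext D g (\<lambda>_. 1) = g D"
  by (induction arbitrary: g rule: finite_induct) (simp_all add: multilinear_ext_insert)

locale slot_system =
  fixes U D :: "nat set" and S :: "nat \<Rightarrow> nat set" and m :: nat and f :: "nat set \<Rightarrow> real"
  assumes finite_U: "finite U" and finite_D: "finite D"
    and S_subset: "u \<in> U \<Longrightarrow> S u \<subseteq> D"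
    and U_subset: "U \<subseteq> {..m}" and m_pos: "0 < m"
    and mono: "monotone_setfun U f" and submod: "submodular_setfun U f"
begin

abbreviation "ok \<equiv> slots_ok U D S"
abbreviation "val \<equiv> slot_value f D"
abbreviation "slope p a \<equiv> partial_diff D (\<lambda>R. f (\<Union>(a ` R))) p"

section \<open>Marginal values of elements and slots\<close>

lemma finite_S: "u \<in> U \<Longrightarrow> finite (S u)"
  using S_subset finite_D finite_subset by metis

text \<open>Submodularity only speaks of \<open>v\<close> outside \<open>Y\<close>. For
  \<open>v\<close> in \<open>Y\<close> the left side is zero and the right side is nonnegative by
  monotonicity.\<close>

lemma marginal_antimono:
  assumes "X \<subseteq> Y" "Y \<subseteq> U" "v \<in> U"
  shows "f (insert v Y) - f Y \<le> f (insert v X) - f X"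
proof (cases "v \<in> Y")
  case True
  then show ?thesis
    using mono assms unfolding monotone_setfun_def
    by (simp add: insert_absorb) (metis insert_subset order_trans subset_insertI)
next
  case False
  then show ?thesis using submod assms unfolding submodular_setfun_def by blast
qed

text \<open>Adding \<open>W\<close> to \<open>X\<close> one element at a time telescopes, each
  increment being at most the marginal at \<open>X\<close>; monotonicity bounds \<open>f W\<close>
  by the value of the union.\<close>

lemma sum_marginals:
  assumes "W \<subseteq> U" "X \<subseteq> U"
  shows "f W \<le> f X + (\<Sum>v\<in>W. f (insert v X) - f X)"
proof -
  have "finite W" using assms(1) finite_U finite_subset by blast
  then have "f (W \<union> X) \<le> f X + (\<Sum>v\<in>W. f (insert v X) - f X)"
    using assms(1)
  proof (induction rule: finite_induct)
    case (insert v W)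
    have "f (insert v (W \<union> X)) - f (W \<union> X) \<le> f (insert v X) - f X"
      using insert.prems assms(2) by (intro marginal_antimono) auto
    then show ?case using insert by simp
  qed simp
  moreover have "f W \<le> f (W \<union> X)"
    using mono assms unfolding monotone_setfun_def by blast
  ultimately show ?thesis by simp
qed

lemma ok_Union: "ok a \<Longrightarrow> R \<subseteq> D \<Longrightarrow> \<Union>(a ` R) \<subseteq> U"
  unfolding slots_ok_def by (intro UN_least) (metis bot.extremum insert_subset subsetD)

text \<open>Adding a slot adds one element or nothing, so submodularity and monotonicity pass from
  \<open>f\<close> to the set function on slots. The first part supplies the hypothesis of
  \<open>multilinear_ext_diagonal\<close>.\<close>

lemma slot_marginal:
  assumes "ok a" "d \<in> D" "R \<subseteq> T" "T \<subseteq> D"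
  shows "f (\<Union>(a ` insert d T)) - f (\<Union>(a ` T)) \<le> f (\<Union>(a ` insert d R)) - f (\<Union>(a ` R))"
    and "0 \<le> f (\<Union>(a ` insert d R)) - f (\<Union>(a ` R))"
proof -
  have RT: "\<Union>(a ` R) \<subseteq> \<Union>(a ` T)" "\<Union>(a ` T) \<subseteq> U" using assms ok_Union by auto
  from assms(1,2) consider "a d = {}" | u where "u \<in> U" "a d = {u}"
    unfolding slots_ok_def by blast
  then show "f (\<Union>(a ` insert d T)) - f (\<Union>(a ` T)) \<le> f (\<Union>(a ` insert d R)) - f (\<Union>(a ` R))"
  proof cases
    case 2
    then show ?thesis using marginal_antimono[OF RT] by simp
  qed simp
  have "\<Union>(a ` insert d R) \<subseteq> U" "\<Union>(a ` R) \<subseteq> \<Union>(a ` insert d R)"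
    using assms ok_Union[of a "insert d R"] by auto
  then show "0 \<le> f (\<Union>(a ` insert d R)) - f (\<Union>(a ` R))"
    using mono unfolding monotone_setfun_def by simp
qed

lemma slope_nonneg:
  assumes "ok a" "0 \<le> p" "p \<le> 1" "d \<in> D"
  shows "0 \<le> slope p a d"
proof -
  have "multilinear_ext (D - {d}) (\<lambda>_. 0) (\<lambda>_. p) \<le> slope p a d"
    unfolding partial_diff_def using assms slot_marginal(2)
    by (intro multilinear_ext_mono) auto
  then show ?thesis using finite_D by (simp add: multilinear_ext_const)
qed

text \<open>Here \<open>u\<close> is added for certain while the slots are thinned; the factor
  \<open>p\<close> for keeping the slot of \<open>u\<close> appears in
  \<open>val_update\<close>.\<close>

definition gain :: "real \<Rightarrow> (nat \<Rightarrow> nat set) \<Rightarrow> nat \<Rightarrow> real" where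
  "gain p a u = multilinear_ext D (\<lambda>R. f (insert u (\<Union>(a ` R))) - f (\<Union>(a ` R))) (\<lambda>_. p)"

lemma sum_gain:
  assumes "ok a" "0 \<le> p" "p \<le> 1" "W \<subseteq> U"
  shows "f W - val p a \<le> (\<Sum>u\<in>W. gain p a u)"
proof -
  have "f W - val p a = multilinear_ext D (\<lambda>R. f W - f (\<Union>(a ` R))) (\<lambda>_. p)"
    using finite_D by (simp add: multilinear_ext_diff multilinear_ext_const slot_value_def)
  also have "\<dots> \<le> multilinear_ext D
      (\<lambda>R. \<Sum>u\<in>W. f (insert u (\<Union>(a ` R))) - f (\<Union>(a ` R))) (\<lambda>_. p)"
  proof (rule multilinear_ext_mono)
    fix R assume "R \<subseteq> D"
    then show "f W - f (\<Union>(a ` R)) \<le> (\<Sum>u\<in>W. f (insert u (\<Union>(a ` R))) - f (\<Union>(a ` R)))"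
      using sum_marginals[OF assms(4) ok_Union[OF assms(1)], of R] by linarith
  qed (use assms in auto)
  finally show ?thesis by (simp add: multilinear_ext_sum gain_def)
qed

text \<open>With probability \<open>p\<close> slot \<open>d\<close> is kept, and then its old
  content is traded for \<open>u\<close>. By submodularity the marginal of \<open>u\<close> over the
  other slots alone is at least its marginal over all of them.\<close>

lemma val_update:
  assumes "ok a" "0 \<le> p" "p \<le> 1" "u \<in> U" "d \<in> D"
  shows "p * (gain p a u - slope p a d) \<le> val p (a(d := {u})) - val p a"
proof -
  let ?D = "D - {d}" and ?g = "\<lambda>R. f (\<Union>(a ` R))" and ?x = "\<lambda>_. p"
  let ?h = "\<lambda>R. f (insert u (\<Union>(a ` R))) - f (\<Union>(a ` R))"
  have D: "D = insert d ?D" "finite ?D" using assms finite_D by auto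
  have ins: "multilinear_ext D g ?x = (1 - p) * multilinear_ext ?D g ?x
      + p * multilinear_ext ?D (\<lambda>R. g (insert d R)) ?x" for g
    using multilinear_ext_insert[OF D(2), of d g ?x] D(1) by simp
  have "multilinear_ext ?D (\<lambda>R. ?h (insert d R)) ?x \<le> multilinear_ext ?D ?h ?x"
    using assms ok_Union[OF assms(1), of "insert d R" for R]
    by (intro multilinear_ext_mono marginal_antimono) auto
  then have "p * multilinear_ext ?D (\<lambda>R. ?h (insert d R)) ?x \<le> p * multilinear_ext ?D ?h ?x"
    using assms(2) by (rule mult_left_mono)
  then have gain: "gain p a u \<le> multilinear_ext ?D ?h ?x"
    unfolding gain_def ins[of ?h] by (simp add: algebra_simps)
  have b: "\<Union>((a(d := {u})) ` R) = \<Union>(a ` R)"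
    "\<Union>((a(d := {u})) ` insert d R) = insert u (\<Union>(a ` R))" if "R \<subseteq> ?D" for R
  proof -
    have eq: "(a(d := {u})) ` R = a ` R" using that by (intro image_cong) auto
    show "\<Union>((a(d := {u})) ` R) = \<Union>(a ` R)" by (simp only: eq)
    show "\<Union>((a(d := {u})) ` insert d R) = insert u (\<Union>(a ` R))"
      by (simp only: image_insert eq fun_upd_same Union_insert insert_is_Un[of u "\<Union>(a ` R)"])
  qed
  have "val p (a(d := {u})) = (1 - p) * multilinear_ext ?D ?g ?x
      + p * multilinear_ext ?D (\<lambda>R. f (insert u (\<Union>(a ` R)))) ?x"
    unfolding slot_value_def ins
    by (intro arg_cong2[of _ _ _ _ "(+)"] arg_cong2[of _ _ _ _ "(*)"] refl
        multilinear_ext_cong) (simp_all only: b)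
  moreover have "val p a = (1 - p) * multilinear_ext ?D ?g ?x
      + p * multilinear_ext ?D (\<lambda>R. ?g (insert d R)) ?x"
    unfolding slot_value_def by (rule ins)
  ultimately have "val p (a(d := {u})) - val p a = p * (multilinear_ext ?D ?h ?x - slope p a d)"
    by (simp add: multilinear_ext_diff partial_diff_def algebra_simps)
  then show ?thesis using gain assms(2) by (simp add: mult_left_mono)
qed

section \<open>One step as an averaging operator\<close>

definition improve :: "real \<Rightarrow> (nat \<Rightarrow> nat set) \<Rightarrow> nat \<Rightarrow> nat \<Rightarrow> nat \<Rightarrow> nat set" where
  "improve p a u d = (if val p a < val p (a(d := {u})) then a(d := {u}) else a)"

lemma ok_improve: "ok a \<Longrightarrow> u \<in> U \<Longrightarrow> d \<in> S u \<Longrightarrow> ok (improve p a u d)"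
  by (simp add: improve_def slots_ok_update)

text \<open>The Markov operator of the search in two stages: \<open>local_step\<close> conditions on
  the drawn number \<open>u\<close>, and \<open>step\<close> averages over it. Finite sums keep the
  analysis apart from the oracle runs.\<close>

definition local_step ::
    "((nat \<Rightarrow> nat set) \<Rightarrow> real) \<Rightarrow> real \<Rightarrow> (nat \<Rightarrow> nat set) \<Rightarrow> nat \<Rightarrow> real" where
  "local_step h p a u =
     (if u \<in> U \<and> S u \<noteq> {} then (\<Sum>d\<in>S u. h (improve p a u d)) / card (S u) else h a)"

definition step :: "((nat \<Rightarrow> nat set) \<Rightarrow> real) \<Rightarrow> real \<Rightarrow> (nat \<Rightarrow> nat set) \<Rightarrow> real" where
  "step h p a = (\<Sum>u\<le>m. local_step h p a u) / (real m + 1)"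

lemma step_mono:
  assumes "ok a" "\<And>b. ok b \<Longrightarrow> h b \<le> h' b"
  shows "step h p a \<le> step h' p a"
  unfolding step_def local_step_def
  using assms ok_improve by (auto intro!: divide_right_mono sum_mono)

lemma step_affine: "step (\<lambda>b. c + r * h b) p a = c + r * step h p a"
proof -
  have "local_step (\<lambda>b. c + r * h b) p a u = c + r * local_step h p a u" for u
    using finite_S[of u]
    by (auto simp: local_step_def sum.distrib sum_distrib_left[symmetric] add_divide_distrib)
  moreover have "real m + 1 \<noteq> 0" by simp
  ultimately show ?thesis
    by (simp add: step_def sum.distrib sum_distrib_left[symmetric] field_simps)
qed

end

text \<open>
  The last assumption says that \<open>W\<close> fits fractionally into the slots: spreading each of its
  elements evenly over its admissible slots uses every slot at most once.
\<close>

locale slot_system_opt = slot_system +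
  fixes W :: "nat set"
  assumes W_subset: "W \<subseteq> U" and S_nonempty: "u \<in> W \<Longrightarrow> S u \<noteq> {}"
    and fits: "(\<And>d. d \<in> D \<Longrightarrow> 0 \<le> c d) \<Longrightarrow>
      (\<Sum>u\<in>W. (\<Sum>d\<in>S u. c d) / card (S u)) \<le> (\<Sum>d\<in>D. c d :: real)"
begin

lemma step_gain:
  assumes "ok a" "0 \<le> p" "p \<le> 1"
  shows "val p a + p / (real m + 1) * (f W - val p a - (\<Sum>d\<in>D. slope p a d)) \<le> step (val p) p a"
proof -
  have imp: "val p (improve p a u d) \<ge> val p a"
    "val p (improve p a u d) \<ge> val p (a(d := {u}))" for u d
    by (auto simp: improve_def)
  have nonneg: "0 \<le> local_step (val p) p a u - val p a" for u
  proof (cases "u \<in> U \<and> S u \<noteq> {}")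
    case True
    then have "0 < card (S u)" using finite_S by (simp add: card_gt_0_iff)
    moreover have "real (card (S u)) * val p a \<le> (\<Sum>d\<in>S u. val p (improve p a u d))"
      by (intro sum_bounded_below imp(1))
    ultimately show ?thesis using True by (simp add: local_step_def le_divide_eq mult.commute)
  qed (auto simp: local_step_def)
  have W: "p * (gain p a u - (\<Sum>d\<in>S u. slope p a d) / card (S u)) \<le>
      local_step (val p) p a u - val p a" if "u \<in> W" for u
  proof -
    have u: "u \<in> U" "S u \<noteq> {}" "card (S u) > 0"
      using that W_subset S_nonempty finite_S by (auto simp: card_gt_0_iff)
    have "(\<Sum>d\<in>S u. val p a + p * (gain p a u - slope p a d)) \<le>
        (\<Sum>d\<in>S u. val p (improve p a u d))"
    proof (rule sum_mono)
      fix d assume "d \<in> S u"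
      then show "val p a + p * (gain p a u - slope p a d) \<le> val p (improve p a u d)"
        using val_update[OF assms u(1), of d] imp(2)[where u = u and d = d] S_subset[OF u(1)] by force
    qed
    then have "(\<Sum>d\<in>S u. val p a + p * (gain p a u - slope p a d)) / card (S u) \<le>
        local_step (val p) p a u"
      using u by (simp add: local_step_def divide_right_mono)
    also have "(\<Sum>d\<in>S u. val p a + p * (gain p a u - slope p a d)) / card (S u) =
        val p a + p * (gain p a u - (\<Sum>d\<in>S u. slope p a d) / card (S u))"
      using u by (simp add: sum.distrib sum_distrib_left[symmetric] sum_subtractf
          add_divide_distrib diff_divide_distrib right_diff_distrib)
    finally show ?thesis by simp
  qed
  have "f W - val p a - (\<Sum>d\<in>D. slope p a d) \<le>
      (\<Sum>u\<in>W. gain p a u - (\<Sum>d\<in>S u. slope p a d) / card (S u))"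
    using sum_gain[OF assms W_subset] fits[of "slope p a"] slope_nonneg[OF assms]
    by (simp add: sum_subtractf)
  then have "p * (f W - val p a - (\<Sum>d\<in>D. slope p a d)) \<le>
      (\<Sum>u\<in>W. p * (gain p a u - (\<Sum>d\<in>S u. slope p a d) / card (S u)))"
    unfolding sum_distrib_left[symmetric] using assms(2) by (rule mult_left_mono)
  also have "\<dots> \<le> (\<Sum>u\<in>W. local_step (val p) p a u - val p a)"
    by (intro sum_mono W)
  also have "\<dots> \<le> (\<Sum>u\<le>m. local_step (val p) p a u - val p a)"
    using nonneg W_subset U_subset by (intro sum_mono2) auto
  also have "\<dots> = (real m + 1) * (step (val p) p a - val p a)"
    by (simp add: step_def sum_subtractf field_simps)
  finally have "p * (f W - val p a - (\<Sum>d\<in>D. slope p a d)) \<le>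
      (real m + 1) * (step (val p) p a - val p a)" .
  then show ?thesis by (simp add: field_simps)
qed

text \<open>
  The gain of a step loses the slope of the value along the diagonal, and raising the scale from
  \<open>(1 - 1/m) p\<close> to \<open>p\<close> recovers it.
\<close>

lemma step_scale:
  assumes "ok a" "0 \<le> p" "p \<le> 1"
  defines "\<delta> \<equiv> p / (real m + 1)"
  shows "(1 - \<delta>) * val ((1 - 1 / real m) * p) a + \<delta> * f W \<le> step (val p) p a"
proof -
  let ?q = "(1 - 1 / real m) * p" and ?s = "\<Sum>d\<in>D. slope p a d"
  have \<delta>: "\<delta> \<le> 1" using assms(2,3) by (simp add: \<delta>_def)
  have s: "0 \<le> ?s" using slope_nonneg[OF assms(1-3)] by (rule sum_nonneg)
  have m: "0 < real m" using m_pos by simp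
  have q: "0 \<le> ?q" "?q \<le> p"
    using m_pos assms(2) by (auto intro!: mult_nonneg_nonneg mult_left_le_one_le)
  have "val ?q a + (p - ?q) * ?s \<le> val p a"
    unfolding slot_value_def
    by (rule multilinear_ext_diagonal[OF finite_D q assms(3)]) (rule slot_marginal(1)[OF assms(1)])
  then have "val ?q a + p / real m * ?s \<le> val p a"
    using m by (simp add: left_diff_distrib)
  then have "(1 - \<delta>) * (val ?q a + p / real m * ?s) \<le> (1 - \<delta>) * val p a"
    using \<delta> by (intro mult_left_mono) auto
  \<comment> \<open>The recovered slope covers the lost one: drawing among \<open>m + 1\<close>
    numbers against shrinking the scale by \<open>1 - 1/m\<close> leaves the surplus
    \<open>p (1 - p) / (m (m + 1))\<close> per unit of slope.\<close>
  moreover have "\<delta> * ?s \<le> (1 - \<delta>) * (p / real m) * ?s"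
  proof (rule mult_right_mono[OF _ s])
    have "(1 - \<delta>) * (p / real m) - \<delta> = p * (1 - p) / (real m * (real m + 1))"
      unfolding \<delta>_def using m by (simp add: divide_simps) (simp add: algebra_simps)
    also have "\<dots> \<ge> 0" using assms(2,3) m by simp
    finally show "\<delta> \<le> (1 - \<delta>) * (p / real m)" by simp
  qed
  moreover have "(1 - \<delta>) * val p a + \<delta> * f W - \<delta> * ?s \<le> step (val p) p a"
    using step_gain[OF assms(1-3), folded \<delta>_def] by (simp add: algebra_simps)
  ultimately show ?thesis by (simp add: algebra_simps)
qed

section \<open>The expected value of a run\<close>

abbreviation "result t a \<equiv> run (multilinear_ext U f) (slot_search U D S m t a)"

text \<open>On states satisfying the invariant the oracle answers with \<open>slot_value\<close>, so
  the comparison made by the search agrees with \<open>improve\<close>.\<close>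

lemma expected_value_Suc:
  assumes "ok a"
  shows "expected_value f (result (Suc t) a) =
    step (\<lambda>b. expected_value f (result t b)) ((1 - 1 / real m) ^ t) a"
proof -
  let ?p = "(1 - 1 / real m) ^ t" and ?F = "multilinear_ext U f"
  let ?step = "\<lambda>u. if u \<in> U \<and> S u \<noteq> {} then
         Sample (pmf_of_set (S u)) (\<lambda>d.
           Query (slot_point D ?p a) (\<lambda>y.
             Query (slot_point D ?p (a(d := {u}))) (\<lambda>z.
               slot_search U D S m t (if y < z then a(d := {u}) else a))))
       else slot_search U D S m t a"
  have val: "?F (slot_point D ?p b) = val ?p b" if "ok b" for b
    using that unfolding slots_ok_def
    by (intro multilinear_ext_slot_point finite_U finite_D) blast
  have fin: "finite (set_pmf (result t b))" for b
    by (intro finite_set_run_slot_search finite_S)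
  have "expected_value f (run ?F (?step u)) =
      local_step (\<lambda>b. expected_value f (result t b)) ?p a u" for u
  proof (cases "u \<in> U \<and> S u \<noteq> {}")
    case True
    then have "expected_value f (run ?F (?step u)) = (\<Sum>d\<in>S u. measure_pmf.expectation
        (map_pmf (\<lambda>(A, q). (A, Suc q)) (map_pmf (\<lambda>(A, q). (A, Suc q))
          (run ?F (slot_search U D S m t (if ?F (slot_point D ?p a) <
            ?F (slot_point D ?p (a(d := {u}))) then a(d := {u}) else a)))))
        (\<lambda>z. f (fst z)) / card (S u))"
      unfolding expected_value_def using finite_S fin
      by (simp, subst pmf_expectation_bind_pmf_of_set)
        (auto simp: fin divide_inverse mult.commute)
    also have "\<dots> = (\<Sum>d\<in>S u. expected_value f (result t (improve ?p a u d)) / card (S u))"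
      using True assms
      by (intro sum.cong refl)
        (simp add: expected_value_def integral_map_pmf case_prod_unfold improve_def val slots_ok_update)
    finally show ?thesis using True by (simp add: local_step_def sum_divide_distrib)
  next
    case False
    then show ?thesis unfolding local_step_def by (simp only: if_False)
  qed
  moreover have "finite (set_pmf (run ?F (?step u)))" for u
    using finite_S[of u] fin by auto
  then have "expected_value f (result (Suc t) a) =
      (\<Sum>u\<le>m. expected_value f (run ?F (?step u)) / (real m + 1))"
    unfolding expected_value_def slot_search.simps run.simps
    by (subst pmf_expectation_bind_pmf_of_set) (auto simp: divide_inverse mult.commute add.commute)
  ultimately show ?thesis by (simp add: step_def sum_divide_distrib)
qed

text \<open>A state with \<open>t\<close> steps left is valued at the scale with exponent
  \<open>t\<close>. At the end this scale is 1, every slot is kept, and the value is that of the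
  output. By \<open>step_scale\<close>, a step at scale \<open>p\<close> leaves an expected gap to
  \<open>f W\<close> of at most \<open>1 - p / (m + 1)\<close> times the old one.\<close>

lemma expected_value_search:
  assumes "ok a"
  shows "f W - (\<Prod>s<t. 1 - (1 - 1 / real m) ^ s / (real m + 1)) *
      (f W - val ((1 - 1 / real m) ^ t) a) \<le> expected_value f (result t a)"
  using assms
proof (induction t arbitrary: a)
  case 0
  then show ?case
    by (simp add: expected_value_def slot_value_def multilinear_ext_one[OF finite_D])
next
  case (Suc t)
  let ?p = "(1 - 1 / real m) ^ t"
  let ?P = "\<Prod>s<t. 1 - (1 - 1 / real m) ^ s / (real m + 1)"
  have p01: "0 \<le> (1 - 1 / real m) ^ s" "(1 - 1 / real m) ^ s \<le> 1" for s
    using m_pos by (auto intro!: power_le_one)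
  have P: "0 \<le> ?P"
    using p01 by (intro prod_nonneg) (simp add: add_increasing)
  let ?\<delta> = "?p / (real m + 1)"
  \<comment> \<open>The lower bound of the induction hypothesis is affine in \<open>val\<close>, so
    it commutes with the averaging in \<open>step\<close>.\<close>
  have "f W - ?P * (f W - step (val ?p) ?p a) =
      step (\<lambda>b. (f W - ?P * f W) + ?P * val ?p b) ?p a"
    unfolding step_affine by (simp add: algebra_simps)
  also have "\<dots> \<le> step (\<lambda>b. expected_value f (result t b)) ?p a"
    using Suc by (intro step_mono) (auto simp: algebra_simps)
  also have "\<dots> = expected_value f (result (Suc t) a)"
    by (rule expected_value_Suc[OF Suc.prems, symmetric])
  finally have 1: "f W - ?P * (f W - step (val ?p) ?p a) \<le> expected_value f (result (Suc t) a)" .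
  have "f W - step (val ?p) ?p a \<le> (1 - ?\<delta>) * (f W - val ((1 - 1 / real m) ^ Suc t) a)"
    using step_scale[OF Suc.prems p01, of t] by (simp add: algebra_simps)
  then have "?P * (f W - step (val ?p) ?p a) \<le>
      ?P * ((1 - ?\<delta>) * (f W - val ((1 - 1 / real m) ^ Suc t) a))"
    using P by (rule mult_left_mono)
  with 1 show ?case by (simp only: prod.lessThan_Suc mult.assoc)
qed

end

section \<open>Partition matroids\<close>

text \<open>By \<open>1 - x \<le> exp (- x)\<close> the product is at most the exponential of a
  negated geometric sum. The bound on \<open>N\<close> makes the last scale at most
  \<open>\<epsilon> / 2\<close>, the bound on \<open>m\<close> gives
  \<open>m / (m + 1) \<ge> 1 - \<epsilon> / 2\<close>, so the sum is at least
  \<open>1 - \<epsilon>\<close>. The chord of \<open>exp\<close> over \<open>[-1, 0]\<close>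
  finishes.\<close>

lemma schedule_bound:
  fixes \<epsilon> :: real
  assumes \<epsilon>: "0 < \<epsilon>" "\<epsilon> \<le> 1" and m: "2 / \<epsilon> \<le> real m" and N: "real m * ln (2 / \<epsilon>) \<le> real N"
  shows "(\<Prod>s<N. 1 - (1 - 1 / real m) ^ s / (real m + 1)) \<le> 1 - (1 - \<epsilon>) * (1 - 1 / exp 1)"
proof -
  let ?\<rho> = "1 - 1 / real m"
  have m2: "2 \<le> real m" using \<epsilon> m by (smt (verit) le_divide_eq_1_pos divide_le_eq mult_left_le)
  then have \<rho>: "0 \<le> ?\<rho>" "?\<rho> < 1" by simp_all
  have "(\<Prod>s<N. 1 - ?\<rho> ^ s / (real m + 1)) \<le> (\<Prod>s<N. exp (- (?\<rho> ^ s / (real m + 1))))"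
  proof (rule prod_mono)
    fix s
    have "?\<rho> ^ s \<le> 1" using \<rho> by (intro power_le_one) auto
    then have "?\<rho> ^ s / (real m + 1) \<le> 1" using m2 by simp
    then show "0 \<le> 1 - ?\<rho> ^ s / (real m + 1) \<and>
        1 - ?\<rho> ^ s / (real m + 1) \<le> exp (- (?\<rho> ^ s / (real m + 1)))"
      using exp_ge_add_one_self[of "- (?\<rho> ^ s / (real m + 1))"] by simp
  qed
  also have "\<dots> = exp (- ((\<Sum>s<N. ?\<rho> ^ s) / (real m + 1)))"
    by (simp add: exp_sum[symmetric] sum_negf sum_divide_distrib)
  also have "(\<Sum>s<N. ?\<rho> ^ s) = real m * (1 - ?\<rho> ^ N)"
    using \<rho> m2 by (subst sum_gp_strict) (simp add: field_simps)
  also have "exp (- (real m * (1 - ?\<rho> ^ N) / (real m + 1))) \<le> exp (- (1 - \<epsilon>))"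
  proof -
    have "?\<rho> ^ N \<le> exp (- (1 / real m)) ^ N"
      using \<rho> exp_ge_add_one_self[of "- (1 / real m)"] by (intro power_mono) auto
    also have "\<dots> = exp (- (real N / real m))"
      by (simp add: exp_of_nat_mult[symmetric])
    also have "\<dots> \<le> exp (- ln (2 / \<epsilon>))"
      using N m2 by (simp add: field_simps)
    also have "\<dots> = \<epsilon> / 2" using \<epsilon> by (simp add: exp_minus)
    finally have 1: "1 - \<epsilon> / 2 \<le> 1 - ?\<rho> ^ N" by simp
    have "2 \<le> \<epsilon> * real m" using m \<epsilon> by (simp add: field_simps)
    then have 2: "1 - \<epsilon> / 2 \<le> real m / (real m + 1)"
      using m2 \<epsilon> by (simp add: field_simps)
    have "(1 - \<epsilon> / 2) * (1 - \<epsilon> / 2) \<le> real m / (real m + 1) * (1 - ?\<rho> ^ N)"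
      using 1 2 \<epsilon> m2 by (intro mult_mono) auto
    moreover have "1 - \<epsilon> \<le> (1 - \<epsilon> / 2) * (1 - \<epsilon> / 2)" by (simp add: algebra_simps)
    ultimately show ?thesis by simp
  qed
  also have "exp (- (1 - \<epsilon>)) \<le> \<epsilon> * exp 0 + (1 - \<epsilon>) * exp (- 1)"
    using convex_onD[OF exp_convex, of "1 - \<epsilon>" 0 "- 1"] \<epsilon> by simp
  also have "\<dots> = 1 - (1 - \<epsilon>) * (1 - 1 / exp 1)"
    by (simp add: exp_minus field_simps)
  finally show ?thesis .
qed

text \<open>Slots are natural numbers, and pairing with the block index keeps those of different
  blocks disjoint.\<close>

definition block_slots :: "(nat \<Rightarrow> nat) \<Rightarrow> nat \<Rightarrow> nat set" where
  "block_slots l j = (\<lambda>s. prod_encode (j, s)) ` {..<l j}"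

definition block :: "nat \<Rightarrow> (nat \<Rightarrow> nat set) \<Rightarrow> nat \<Rightarrow> nat" where
  "block k V u = (SOME j. j \<in> {1..k} \<and> u \<in> V j)"

text \<open>In \<open>m\<close> the first summand controls the discretization error, and the second
  ensures that \<open>{..m}\<close> contains \<open>U\<close>. The number of steps brings the
  starting scale down to at most \<open>\<epsilon> / 2\<close>.\<close>

definition partition_search ::
    "nat set \<Rightarrow> nat \<Rightarrow> (nat \<Rightarrow> nat set) \<Rightarrow> (nat \<Rightarrow> nat) \<Rightarrow> real \<Rightarrow> oracle_alg" where
  "partition_search U k V l \<epsilon> =
     (let m = nat \<lceil>2 / \<epsilon>\<rceil> + \<Sum>U in
      slot_search U (\<Union>j\<in>{1..k}. block_slots l j) (\<lambda>u. block_slots l (block k V u)) m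
        (nat \<lceil>real m * ln (2 / \<epsilon>)\<rceil>) (\<lambda>_. {}))"

section \<open>Independent sets and slots\<close>

lemma card_block_slots [simp]: "card (block_slots l j) = l j"
  unfolding block_slots_def by (subst card_image) (auto simp: inj_on_def)

lemma finite_block_slots [simp]: "finite (block_slots l j)"
  by (simp add: block_slots_def)

lemma disjoint_block_slots: "i \<noteq> j \<Longrightarrow> block_slots l i \<inter> block_slots l j = {}"
  by (auto simp: block_slots_def)

lemma block_mem:
  assumes "gen_partition U k V" "u \<in> U"
  shows "block k V u \<in> {1..k}" "u \<in> V (block k V u)"
proof -
  have "\<exists>j. j \<in> {1..k} \<and> u \<in> V j" using assms by (auto simp: gen_partition_def)
  from someI_ex[OF this] show "block k V u \<in> {1..k}" "u \<in> V (block k V u)"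
    by (simp_all add: block_def)
qed

lemma block_eq:
  assumes "gen_partition U k V" "j \<in> {1..k}" "u \<in> V j"
  shows "block k V u = j"
proof -
  have "u \<in> U" using assms unfolding gen_partition_def by blast
  then show ?thesis
    using assms block_mem[OF assms(1)] unfolding gen_partition_def disjoint_family_on_def by blast
qed

text \<open>An output element of \<open>V j\<close> sits in a slot of block \<open>j\<close>, and a
  slot holds at most one element, so the \<open>l j\<close> slots of the block cover the
  intersection. The value of \<open>THE\<close> at empty slots can only enlarge the covering
  image.\<close>

lemma slots_ok_indep:
  assumes "gen_partition U k V"
    and "slots_ok U (\<Union>j\<in>{1..k}. block_slots l j) (\<lambda>u. block_slots l (block k V u)) a"
  shows "\<Union>(a ` (\<Union>j\<in>{1..k}. block_slots l j)) \<in> gen_partition_indep U k V l"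
proof -
  let ?D = "\<Union>j\<in>{1..k}. block_slots l j"
  have "card (\<Union>(a ` ?D) \<inter> V j) \<le> l j" if j: "j \<in> {1..k}" for j
  proof -
    have "\<Union>(a ` ?D) \<inter> V j \<subseteq> (\<lambda>d. THE u. a d = {u}) ` block_slots l j"
    proof
      fix v assume "v \<in> \<Union>(a ` ?D) \<inter> V j"
      then obtain d where d: "d \<in> ?D" "v \<in> a d" "v \<in> V j" by blast
      then have "a d = {v}" "d \<in> block_slots l (block k V v)"
        using assms(2) unfolding slots_ok_def by fastforce+
      then show "v \<in> (\<lambda>d. THE u. a d = {u}) ` block_slots l j"
        using block_eq[OF assms(1) j d(3)] by (intro image_eqI[of _ _ d]) auto
    qed
    then have "card (\<Union>(a ` ?D) \<inter> V j) \<le> card (block_slots l j)"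
      by (rule surj_card_le[rotated]) simp
    then show ?thesis by simp
  qed
  moreover have "\<Union>(a ` ?D) \<subseteq> U"
    using assms(2) unfolding slots_ok_def
    by (intro UN_least) (metis bot.extremum insert_subset)
  ultimately show ?thesis by (simp add: gen_partition_indep_def)
qed

text \<open>Grouped by blocks, block \<open>j\<close> contributes
  \<open>card (W \<inter> V j) / l j\<close> times the total weight of its slots, and independence
  bounds this ratio by 1.\<close>

lemma indep_fits:
  fixes c :: "nat \<Rightarrow> real"
  assumes "gen_partition U k V" "W \<in> gen_partition_indep U k V l"
    and "\<And>d. d \<in> (\<Union>j\<in>{1..k}. block_slots l j) \<Longrightarrow> 0 \<le> c d"
  shows "(\<Sum>u\<in>W. (\<Sum>d\<in>block_slots l (block k V u). c d) / card (block_slots l (block k V u)))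
    \<le> (\<Sum>d\<in>(\<Union>j\<in>{1..k}. block_slots l j). c d)"
proof -
  let ?C = "\<lambda>j. \<Sum>d\<in>block_slots l j. c d"
  have W: "W \<subseteq> U" "finite W" and card: "\<And>j. j \<in> {1..k} \<Longrightarrow> card (W \<inter> V j) \<le> l j"
    using assms(1,2) finite_subset unfolding gen_partition_def gen_partition_indep_def by auto
  have "(\<Sum>u\<in>W. ?C (block k V u) / card (block_slots l (block k V u))) =
      (\<Sum>j\<in>{1..k}. \<Sum>u\<in>{u \<in> W. block k V u = j}. ?C (block k V u) / l (block k V u))"
    using W block_mem[OF assms(1)] by (subst sum.group) auto
  also have "\<dots> \<le> (\<Sum>j\<in>{1..k}. ?C j)"
  proof (rule sum_mono)
    fix j assume j: "j \<in> {1..k}"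
    have C: "0 \<le> ?C j" using j assms(3) by (intro sum_nonneg) blast
    have "{u \<in> W. block k V u = j} = W \<inter> V j"
      using W block_mem[OF assms(1)] block_eq[OF assms(1) j] by auto
    moreover have "(\<Sum>u\<in>{u \<in> W. block k V u = j}. ?C (block k V u) / l (block k V u)) =
        real (card {u \<in> W. block k V u = j}) * (?C j / l j)"
      by simp
    ultimately have "(\<Sum>u\<in>{u \<in> W. block k V u = j}. ?C (block k V u) / l (block k V u)) =
        real (card (W \<inter> V j)) * (?C j / l j)"
      by simp
    also have "\<dots> \<le> real (l j) * (?C j / l j)"
      using card[OF j] C by (intro mult_right_mono divide_nonneg_nonneg) auto
    \<comment> \<open>For \<open>l j = 0\<close> the product is zero and nonnegativity of the
      weights suffices.\<close>
    also have "\<dots> \<le> ?C j"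
      using C by (cases "l j = 0") auto
    finally show "(\<Sum>u\<in>{u \<in> W. block k V u = j}. ?C (block k V u) / l (block k V u)) \<le> ?C j" .
  qed
  also have "\<dots> = (\<Sum>d\<in>(\<Union>j\<in>{1..k}. block_slots l j). c d)"
    using disjoint_block_slots by (intro sum.UNION_disjoint[symmetric]) auto
  finally show ?thesis .
qed

text \<open>The factor \<open>m + 1\<close> cancels, so refining the time steps costs no queries.
  What remains is linear in the logarithm: \<open>ln 2 + ln (1 / \<epsilon>) + 1\<close> is at most
  three times \<open>?L\<close>, and two queries per step give 6.\<close>

lemma query_count_bound:
  fixes \<epsilon> :: real
  assumes "0 < \<epsilon>" "\<epsilon> \<le> 1"
  shows "real (nat \<lceil>real m * ln (2 / \<epsilon>)\<rceil>) * (2 * real n / (real m + 1)) \<le> 6 * n_log_sq n \<epsilon>"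
proof -
  let ?L = "max 1 (ln (1 / \<epsilon>))"
  have ln: "ln (2 / \<epsilon>) = ln 2 + ln (1 / \<epsilon>)" "0 \<le> ln (1 / \<epsilon>)"
    using assms ln_mult[of 2 "1 / \<epsilon>"] by simp_all
  have "(real m * ln (2 / \<epsilon>)) \<ge> 0" using ln by (intro mult_nonneg_nonneg) auto
  then have "real (nat \<lceil>real m * ln (2 / \<epsilon>)\<rceil>) \<le> real m * ln (2 / \<epsilon>) + 1"
    by linarith
  also have "\<dots> \<le> (real m + 1) * (ln (2 / \<epsilon>) + 1)"
    using ln by (simp add: algebra_simps)
  also have "\<dots> \<le> (real m + 1) * (3 * ?L)"
    using ln ln_2_less_1 by (intro mult_left_mono) auto
  finally have "real (nat \<lceil>real m * ln (2 / \<epsilon>)\<rceil>) * (2 * real n / (real m + 1)) \<le>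
      (real m + 1) * (3 * ?L) * (2 * real n / (real m + 1))"
    by (intro mult_right_mono) auto
  also have "\<dots> = 6 * real n * ?L" by simp
  also have "\<dots> \<le> 6 * real n * ?L\<^sup>2"
    using self_le_power[of ?L 2] by (intro mult_left_mono) auto
  finally show ?thesis by (simp add: n_log_sq_def)
qed

theorem theorem1p6:
  "\<exists>(alg :: nat set \<Rightarrow> nat \<Rightarrow> (nat \<Rightarrow> nat set) \<Rightarrow> (nat \<Rightarrow> nat) \<Rightarrow> real \<Rightarrow> oracle_alg) (C :: real).
     \<forall>(U :: nat set) (k :: nat) (V :: nat \<Rightarrow> nat set) (l :: nat \<Rightarrow> nat) (\<epsilon> :: real).
       gen_partition U k V \<and> 0 < \<epsilon> \<and> \<epsilon> \<le> 1 \<longrightarrow>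
         queries_in_cube U (alg U k V l \<epsilon>) \<and>
         (\<forall>(f :: nat set \<Rightarrow> real) (Opt :: nat set).
            nonneg_setfun U f \<and> monotone_setfun U f \<and> submodular_setfun U f \<and>
            is_arg_max f (\<lambda>S. S \<in> gen_partition_indep U k V l) Opt \<longrightarrow>
              (let r = run (multilinear_ext U f) (alg U k V l \<epsilon>) in
                 expected_queries r \<le> ennreal (C * n_log_sq (card U) \<epsilon>) \<and>
                 (\<forall>A \<in> fst ` set_pmf r. A \<in> gen_partition_indep U k V l) \<and>
                 expected_value f r \<ge> (1 - \<epsilon>) * (1 - 1 / exp 1) * f Opt))"
proof (intro exI[of _ partition_search] exI[of _ 6] allI impI conjI)
  fix U k V l and \<epsilon> :: real
  assume *: "gen_partition U k V \<and> 0 < \<epsilon> \<and> \<epsilon> \<le> 1"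
  then have part: "gen_partition U k V" and \<epsilon>: "0 < \<epsilon>" "\<epsilon> \<le> 1" by auto
  have fin: "finite U" using part by (simp add: gen_partition_def)
  let ?D = "\<Union>j\<in>{1..k}. block_slots l j" and ?S = "\<lambda>u. block_slots l (block k V u)"
  define m where "m = nat \<lceil>2 / \<epsilon>\<rceil> + \<Sum>U"
  define N where "N = nat \<lceil>real m * ln (2 / \<epsilon>)\<rceil>"
  have alg: "partition_search U k V l \<epsilon> = slot_search U ?D ?S m N (\<lambda>_. {})"
    by (simp add: partition_search_def m_def N_def Let_def)
  have m: "2 / \<epsilon> \<le> real m" unfolding m_def by linarith
  then have m0: "0 < m" using \<epsilon> by (cases "m = 0") (auto simp: field_simps)
  have Um: "U \<subseteq> {..m}"
    using member_le_sum[of _ U "\<lambda>u. u"] fin by (auto simp: m_def intro: trans_le_add2)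
  show "queries_in_cube U (partition_search U k V l \<epsilon>)"
    unfolding alg by (rule queries_in_cube_slot_search[OF m0])
  fix f Opt
  assume f: "nonneg_setfun U f \<and> monotone_setfun U f \<and> submodular_setfun U f \<and>
    is_arg_max f (\<lambda>S. S \<in> gen_partition_indep U k V l) Opt"
  then have Opt: "Opt \<in> gen_partition_indep U k V l" by (simp add: is_arg_max_def)
  have ok: "slots_ok U ?D ?S (\<lambda>_. {})" by (simp add: slots_ok_def)
  interpret slot_system_opt U ?D ?S m f Opt
  proof
    \<comment> \<open>An element of \<open>Opt\<close> forces a positive bound on its block, hence
      at least one slot.\<close>
    show "?S u \<noteq> {}" if "u \<in> Opt" for u
    proof -
      have u: "u \<in> U" and fo: "finite Opt"
        using that Opt fin finite_subset by (auto simp: gen_partition_indep_def)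
      then have "0 < card (Opt \<inter> V (block k V u))"
        using that block_mem[OF part u] by (auto simp: card_gt_0_iff)
      also have "\<dots> \<le> l (block k V u)"
        using Opt block_mem(1)[OF part u] by (simp add: gen_partition_indep_def)
      finally show ?thesis by (auto simp: block_slots_def)
    qed
    show "?S u \<subseteq> ?D" if "u \<in> U" for u using block_mem(1)[OF part that] by blast
    show "Opt \<subseteq> U" using Opt by (simp add: gen_partition_indep_def)
  qed (use f fin Um m0 indep_fits[OF part Opt] in auto)
  let ?P = "\<Prod>s<N. 1 - (1 - 1 / real m) ^ s / (real m + 1)"
  have "real m * ln (2 / \<epsilon>) \<le> real N" unfolding N_def by linarith
  then have P: "?P \<le> 1 - (1 - \<epsilon>) * (1 - 1 / exp 1)"
    using schedule_bound \<epsilon> m by blast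
  have P0: "0 \<le> ?P"
  proof (intro prod_nonneg ballI)
    fix s
    have "(1 - 1 / real m) ^ s \<le> 1" using m0 by (intro power_le_one) auto
    then show "0 \<le> 1 - (1 - 1 / real m) ^ s / (real m + 1)" by simp
  qed
  have nonneg: "0 \<le> f {}" "0 \<le> f Opt"
    using f W_subset by (auto simp: nonneg_setfun_def)
  have "(1 - \<epsilon>) * (1 - 1 / exp 1) * f Opt \<le> (1 - ?P) * f Opt"
    using P nonneg by (intro mult_right_mono) auto
  \<comment> \<open>The search starts with empty slots, whose value is \<open>f {} \<ge> 0\<close>
    at every scale, so the initial gap is at most \<open>f Opt\<close>.\<close>
  also have "\<dots> \<le> f Opt - ?P * (f Opt - slot_value f ?D ((1 - 1 / real m) ^ N) (\<lambda>_. {}))"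
    using P0 nonneg by (simp add: slot_value_def multilinear_ext_const algebra_simps)
  also have "\<dots> \<le> expected_value f (result N (\<lambda>_. {}))"
    by (rule expected_value_search[OF ok])
  finally have guarantee: "(1 - \<epsilon>) * (1 - 1 / exp 1) * f Opt \<le> expected_value f (result N (\<lambda>_. {}))" .
  have "expected_queries (result N (\<lambda>_. {})) \<le> ennreal (real N * (2 * real (card U) / (real m + 1)))"
    by (intro expected_queries_slot_search finite_S Um)
  also have "\<dots> \<le> ennreal (6 * n_log_sq (card U) \<epsilon>)"
    unfolding N_def by (intro ennreal_leI query_count_bound \<epsilon>)
  finally have queries: "expected_queries (result N (\<lambda>_. {})) \<le> ennreal (6 * n_log_sq (card U) \<epsilon>)" .
  have "A \<in> gen_partition_indep U k V l" if A: "A \<in> fst ` set_pmf (result N (\<lambda>_. {}))" for A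
    using output_slot_search[OF finite_S ok A] slots_ok_indep[OF part] by blast
  with guarantee queries show "let r = run (multilinear_ext U f) (partition_search U k V l \<epsilon>) in
      expected_queries r \<le> ennreal (6 * n_log_sq (card U) \<epsilon>) \<and>
      (\<forall>A \<in> fst ` set_pmf r. A \<in> gen_partition_indep U k V l) \<and>
      expected_value f r \<ge> (1 - \<epsilon>) * (1 - 1 / exp 1) * f Opt"
    unfolding alg Let_def by blast
qed

end
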